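(* Let $n\ge1$, let $\alpha=(\alpha_1,\dots,\alpha_n)$ be a weak integer composition and let $\beta=(\beta_1,\dots,\beta_n)$ be a list of $n$ different positive integers. Then the sequences of generalized Demazure atoms $\{\mathcal{A}_{\beta,k\alpha}(\mathbf{x})\}_{k=1}^\infty$ and of non-symmetric integral form Hall--Littlewood polynomials $\{E_{k\alpha}(\mathbf{x};t)\}_{k=1}^\infty$ each satisfy a linear recurrence whose characteristic polynomial has simple roots.
   Context: A weak integer composition is a vector with non-negative integer entries; $k\alpha=(k\alpha_1,\dots,k\alpha_n)$. An augmented filling $T$ of shape $\alpha$ and basement $\beta$ (a list of $n$ distinct positive integers) is a filling of the boxes $(i,j)$, $1\le i\le n$, $1\le j\le\alpha_i$ ($i$ = row counted from the top, $j$ = column), with positive integers, augmented with a zeroth column (the basement) with entries $T(i,0)=\beta_i$. Two boxes $a,b$ (basement boxes included) are attacking if $T(a)=T(b)$ and either they are in the same column, or they are in adjacent columns with the rightmost box in a row strictly below the other box. A filling is non-attacking if it has no attacking pair of boxes. Triples in an augmented filling with weakly decreasing rows (basement boxes included). A triple of type A: boxes $a,b,c$ with $a$ immediately left of $b$, $c$ in the column of $b$ somewhere below $b$, and the row containing $a,b$ at least as long as the row containing $c$. A triple of type B: boxes $a,b,c$ with $a$ immediately left of $b$, $c$ in the column of $a$ somewhere above $a$, and the row containing $a,b$ strictly longer than the row containing $c$. A triple of either type is an inversion triple if $T(a)\ge T(c)\ge T(b)$. A semi-standard augmented filling is an augmented filling with weakly decreasing rows and without inversion triples; $\mathrm{SSAF}(\beta,\alpha)$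 is the (finite) set of those with basement $\beta$ and shape $\alpha$. The weight $w(T)=(w_1,w_2,\dots)$ has $w_i$ = number of boxes with content $i$, not including the basement, and $\mathbf{x}^{w(T)}=\prod_i x_i^{w_i}$. The generalized Demazure atoms are $$\mathcal{A}_{\beta,\alpha}(\mathbf{x})=\sum_{T\in\mathrm{SSAF}(\beta,\alpha)}\mathbf{x}^{w(T)}.$$ Let $\mathrm{NAWF}(\alpha)$ be the set of non-attacking augmented fillings of shape $\alpha$ with weakly decreasing rows and basement $\beta_i=i$. Define $$E_\alpha(\mathbf{x};t)=\sum_{T\in\mathrm{NAWF}(\alpha)}\mathbf{x}^{w(T)}t^{\mathrm{coinv}(T)}(1-t)^{\mathrm{dn}(T)},$$ where $\mathrm{coinv}(T)$ is the number of triples (of types A and B) in $T$ that are not inversion triples and $\mathrm{dn}(T)$ is the number of pairs of adjacent boxes $(i,j),(i,j+1)$ with $T(i,j)\ne T(i,j+1)$. A sequence $\{a_k\}_{k\ge1}$ of polynomials satisfies a linear recurrence with characteristic polynomial $u^r+c_1u^{r-1}+\dots+c_r$ (in an auxiliary variable $u$, with $c_i$ polynomials in the given variables, independent of $k$) if $a_k+c_1a_{k-1}+\dots+c_ra_{k-r}=0$ for all $k\ge r+1$. Simple roots means that the characteristic polynomial factors as $\prod_i(u-\rho_i)$ with pairwise distinct polynomials $\rho_i$. *)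

theory Defs
  imports
    "HOL-Library.Poly_Mapping"
    "HOL-Library.FuncSet"
    "HOL-Computational_Algebra.Polynomial"
begin

text \<open>
  Compositions, basements and fillings are one-based: a composition or basement with \<open>n\<close> parts is
  a function on \<^typ>\<open>nat\<close> of which only the values at \<open>1, \<dots>, n\<close> matter. A box \<open>(i, j)\<close> lies in
  row \<open>i\<close>, counted from the top, and column \<open>j\<close>; column \<open>0\<close> is the basement.
\<close>

type_synonym box = "nat \<times> nat"
type_synonym filling = "box \<Rightarrow> nat"

definition boxes :: "nat \<Rightarrow> (nat \<Rightarrow> nat) \<Rightarrow> box set" where
  "boxes n \<alpha> = {(i, j). 1 \<le> i \<and> i \<le> n \<and> 1 \<le> j \<and> j \<le> \<alpha> i}"

definition aug_boxes :: "nat \<Rightarrow> (nat \<Rightarrow> nat) \<Rightarrow> box set" where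
  "aug_boxes n \<alpha> = {(i, j). 1 \<le> i \<and> i \<le> n \<and> j \<le> \<alpha> i}"

text \<open>
  Fillings are extensional functions, so that every augmented filling is represented by exactly
  one function.
\<close>

definition aug_fillings :: "nat \<Rightarrow> (nat \<Rightarrow> nat) \<Rightarrow> (nat \<Rightarrow> nat) \<Rightarrow> filling set" where
  "aug_fillings n \<beta> \<alpha> =
     {T \<in> aug_boxes n \<alpha> \<rightarrow>\<^sub>E {0<..}. \<forall>i\<in>{1..n}. T (i, 0) = \<beta> i}"

definition decreasing_rows :: "nat \<Rightarrow> (nat \<Rightarrow> nat) \<Rightarrow> filling \<Rightarrow> bool" where
  "decreasing_rows n \<alpha> T \<longleftrightarrow> (\<forall>i\<in>{1..n}. \<forall>j<\<alpha> i. T (i, Suc j) \<le> T (i, j))"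

definition attacking :: "filling \<Rightarrow> box \<Rightarrow> box \<Rightarrow> bool" where
  "attacking T a b \<longleftrightarrow> a \<noteq> b \<and> T a = T b \<and>
     (snd a = snd b \<or>
      snd b = Suc (snd a) \<and> fst a < fst b \<or>
      snd a = Suc (snd b) \<and> fst b < fst a)"

definition non_attacking :: "nat \<Rightarrow> (nat \<Rightarrow> nat) \<Rightarrow> filling \<Rightarrow> bool" where
  "non_attacking n \<alpha> T \<longleftrightarrow> (\<forall>a\<in>aug_boxes n \<alpha>. \<forall>b\<in>aug_boxes n \<alpha>. \<not> attacking T a b)"

definition triples_A :: "nat \<Rightarrow> (nat \<Rightarrow> nat) \<Rightarrow> (box \<times> box \<times> box) set" where
  "triples_A n \<alpha> =
     {((i, j), (i, Suc j), (i', Suc j)) | i j i'.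
        {(i, j), (i, Suc j), (i', Suc j)} \<subseteq> aug_boxes n \<alpha> \<and> i < i' \<and> \<alpha> i' \<le> \<alpha> i}"

definition triples_B :: "nat \<Rightarrow> (nat \<Rightarrow> nat) \<Rightarrow> (box \<times> box \<times> box) set" where
  "triples_B n \<alpha> =
     {((i, j), (i, Suc j), (i', j)) | i j i'.
        {(i, j), (i, Suc j), (i', j)} \<subseteq> aug_boxes n \<alpha> \<and> i' < i \<and> \<alpha> i' < \<alpha> i}"

definition triples :: "nat \<Rightarrow> (nat \<Rightarrow> nat) \<Rightarrow> (box \<times> box \<times> box) set" where
  "triples n \<alpha> = triples_A n \<alpha> \<union> triples_B n \<alpha>"

fun inversion_triple :: "filling \<Rightarrow> box \<times> box \<times> box \<Rightarrow> bool" where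
  "inversion_triple T (a, b, c) \<longleftrightarrow> T c \<le> T a \<and> T b \<le> T c"

definition SSAF :: "nat \<Rightarrow> (nat \<Rightarrow> nat) \<Rightarrow> (nat \<Rightarrow> nat) \<Rightarrow> filling set" where
  "SSAF n \<beta> \<alpha> = {T \<in> aug_fillings n \<beta> \<alpha>.
     decreasing_rows n \<alpha> T \<and> (\<forall>\<tau>\<in>triples n \<alpha>. \<not> inversion_triple T \<tau>)}"

definition NAWF :: "nat \<Rightarrow> (nat \<Rightarrow> nat) \<Rightarrow> filling set" where
  "NAWF n \<alpha> = {T \<in> aug_fillings n (\<lambda>i. i) \<alpha>.
     decreasing_rows n \<alpha> T \<and> non_attacking n \<alpha> T}"

definition coinv :: "nat \<Rightarrow> (nat \<Rightarrow> nat) \<Rightarrow> filling \<Rightarrow> nat" where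
  "coinv n \<alpha> T = card {\<tau> \<in> triples n \<alpha>. \<not> inversion_triple T \<tau>}"

text \<open>
  Basement boxes are allowed as the left member of a pair. For fillings in \<^const>\<open>NAWF\<close> this makes
  no difference, since their first column agrees with the basement.
\<close>

definition dn :: "nat \<Rightarrow> (nat \<Rightarrow> nat) \<Rightarrow> filling \<Rightarrow> nat" where
  "dn n \<alpha> T = card {(i, j). (i, j) \<in> aug_boxes n \<alpha> \<and> (i, Suc j) \<in> aug_boxes n \<alpha> \<and>
                            T (i, j) \<noteq> T (i, Suc j)}"

definition weight :: "nat \<Rightarrow> (nat \<Rightarrow> nat) \<Rightarrow> filling \<Rightarrow> nat \<Rightarrow> nat" where
  "weight n \<alpha> T v = card {b \<in> boxes n \<alpha>. T b = v}"

text \<open>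
  Integer polynomials in the variables \<open>x\<^sub>i\<close>: finitely supported maps from exponent vectors to
  coefficients. Polynomials in \<open>x\<close> and \<open>t\<close> are univariate polynomials in \<open>t\<close> over this ring.
\<close>

type_synonym xpoly = "(nat \<Rightarrow>\<^sub>0 nat) \<Rightarrow>\<^sub>0 int"

definition Var :: "nat \<Rightarrow> xpoly" where
  "Var i = Poly_Mapping.single (Poly_Mapping.single i 1) 1"

definition tvar :: "xpoly poly" where
  "tvar = [:0, 1:]"

text \<open>Values \<open>v\<close> that do not occur in a box have weight \<open>0\<close> and may be left out of the product.\<close>

definition xweight :: "nat \<Rightarrow> (nat \<Rightarrow> nat) \<Rightarrow> filling \<Rightarrow> xpoly" where
  "xweight n \<alpha> T = (\<Prod>v\<in>T ` boxes n \<alpha>. Var v ^ weight n \<alpha> T v)"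

definition demazure_atom :: "nat \<Rightarrow> (nat \<Rightarrow> nat) \<Rightarrow> (nat \<Rightarrow> nat) \<Rightarrow> xpoly" where
  "demazure_atom n \<beta> \<alpha> = (\<Sum>T\<in>SSAF n \<beta> \<alpha>. xweight n \<alpha> T)"

definition hall_littlewood_E :: "nat \<Rightarrow> (nat \<Rightarrow> nat) \<Rightarrow> xpoly poly" where
  "hall_littlewood_E n \<alpha> =
     (\<Sum>T\<in>NAWF n \<alpha>. [:xweight n \<alpha> T:] * tvar ^ coinv n \<alpha> T * (1 - tvar) ^ dn n \<alpha> T)"

text \<open>
  The sequence \<open>a\<close> is indexed from \<open>1\<close>; its value at \<open>0\<close> is irrelevant. With \<open>r = degree p\<close>, the
  coefficient \<open>c\<^sub>i\<close> of the recurrence is \<open>coeff p (r - i)\<close>.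
\<close>

definition satisfies_recurrence :: "(nat \<Rightarrow> 'a::comm_ring_1) \<Rightarrow> 'a poly \<Rightarrow> bool" where
  "satisfies_recurrence a p \<longleftrightarrow> lead_coeff p = 1 \<and>
     (\<forall>k \<ge> degree p + 1. (\<Sum>i\<le>degree p. coeff p (degree p - i) * a (k - i)) = 0)"

definition simple_roots :: "'a::comm_ring_1 poly \<Rightarrow> bool" where
  "simple_roots p \<longleftrightarrow> (\<exists>S. finite S \<and> p = (\<Prod>\<rho>\<in>S. [:- \<rho>, 1:]))"

text \<open>The sums defining the two families of polynomials are finite.\<close>

lemma finite_aug_boxes: "finite (aug_boxes n \<alpha>)"
proof -
  have "aug_boxes n \<alpha> = Sigma {1..n} (\<lambda>i. {..\<alpha> i})"
    by (auto simp: aug_boxes_def)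
  then show ?thesis by simp
qed

lemma finite_decreasing_fillings:
  "finite {T \<in> aug_fillings n \<beta> \<alpha>. decreasing_rows n \<alpha> T}"
proof (rule finite_subset)
  show "{T \<in> aug_fillings n \<beta> \<alpha>. decreasing_rows n \<alpha> T}
          \<subseteq> (\<Pi>\<^sub>E b \<in> aug_boxes n \<alpha>. {..\<beta> (fst b)})"
  proof
    fix T assume "T \<in> {T \<in> aug_fillings n \<beta> \<alpha>. decreasing_rows n \<alpha> T}"
    then have T: "T \<in> aug_fillings n \<beta> \<alpha>" "decreasing_rows n \<alpha> T"
      by auto
    have "T (i, j) \<le> \<beta> i" if "(i, j) \<in> aug_boxes n \<alpha>" for i j
      using that
    proof (induction j)
      case 0
      then show ?case using T by (auto simp: aug_fillings_def aug_boxes_def)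
    next
      case (Suc j)
      then have "T (i, Suc j) \<le> T (i, j)"
        using T by (auto simp: decreasing_rows_def aug_boxes_def)
      with Suc show ?case by (auto simp: aug_boxes_def)
    qed
    with T show "T \<in> (\<Pi>\<^sub>E b \<in> aug_boxes n \<alpha>. {..\<beta> (fst b)})"
      by (auto simp: aug_fillings_def PiE_iff)
  qed
  show "finite (\<Pi>\<^sub>E b \<in> aug_boxes n \<alpha>. {..\<beta> (fst b)})"
    by (rule finite_PiE) (auto simp: finite_aug_boxes)
qed

lemma finite_SSAF: "finite (SSAF n \<beta> \<alpha>)"
  by (rule finite_subset[OF _ finite_decreasing_fillings[of n \<beta> \<alpha>]]) (auto simp: SSAF_def)

lemma finite_NAWF: "finite (NAWF n \<alpha>)"
  by (rule finite_subset[OF _ finite_decreasing_fillings[of n "\<lambda>i. i" \<alpha>]]) (auto simp: NAWF_def)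

end

theory Submission
  imports Defs
begin

text \<open>
  Both families are computed by a transfer matrix acting on columns, since triples, attacks and
  descents only involve adjacent columns. Stretching by \<open>k\<close> replaces each column of \<open>\<alpha>\<close> by a block
  of \<open>k\<close> columns with the same rows, so the \<open>(k - 1)\<close>-st power of one matrix per block occurs. Rows
  decrease weakly, so every such matrix is triangular with respect to the sum of the entries of a
  column; its diagonal entries \<open>x\<^sup>S\<close>, respectively \<open>x\<^sup>S t\<^sup>c\<close>, determine that sum. Hence the
  eigenvalues met along a strictly descending chain are distinct and the entries of the powers are
  sums \<open>\<Sum>\<^sub>\<rho> c\<^sub>\<rho> \<rho>\<^sup>k\<close> over the fraction field. Such sums are closed under addition and multiplication.
  Columns are kept injective, as otherwise zero eigenvalues could resonate.
\<close>

section \<open>Exponential sums\<close>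

text \<open>The denominator \<open>d\<close> stands in for coefficients in the fraction field.\<close>

definition exp_sum_on :: "'a set \<Rightarrow> (nat \<Rightarrow> 'a::idom) \<Rightarrow> bool" where
  "exp_sum_on S a \<longleftrightarrow> (\<exists>d c. d \<noteq> 0 \<and> (\<forall>k. d * a k = (\<Sum>\<rho>\<in>S. c \<rho> * \<rho> ^ k)))"

definition exp_sum :: "(nat \<Rightarrow> 'a::idom) \<Rightarrow> bool" where
  "exp_sum a \<longleftrightarrow> (\<exists>S. finite S \<and> exp_sum_on S a)"

lemma exp_sum_onI:
  assumes "d \<noteq> 0" "\<And>k. d * a k = (\<Sum>\<rho>\<in>S. c \<rho> * \<rho> ^ k)"
  shows "exp_sum_on S a"
  unfolding exp_sum_on_def using assms by (intro exI[of _ d] exI[of _ c]) simp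

lemma exp_sum_on_mono:
  assumes "exp_sum_on S a" "S \<subseteq> S'" "finite S'"
  shows "exp_sum_on S' a"
proof -
  obtain d c where d: "d \<noteq> 0" and a: "\<And>k. d * a k = (\<Sum>\<rho>\<in>S. c \<rho> * \<rho> ^ k)"
    using assms(1) unfolding exp_sum_on_def by blast
  have eq: "d * a k = (\<Sum>\<rho>\<in>S'. (if \<rho> \<in> S then c \<rho> else 0) * \<rho> ^ k)" for k
    unfolding a using assms(2,3) by (intro sum.mono_neutral_cong_left) auto
  show ?thesis by (rule exp_sum_onI[OF d eq])
qed

lemma exp_sum_on_add:
  assumes "exp_sum_on S a" "exp_sum_on S b"
  shows "exp_sum_on S (\<lambda>k. a k + b k)"
proof -
  obtain d c where d: "d \<noteq> 0" and a: "\<And>k. d * a k = (\<Sum>\<rho>\<in>S. c \<rho> * \<rho> ^ k)"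
    using assms(1) unfolding exp_sum_on_def by blast
  obtain d' c' where d': "d' \<noteq> 0" and b: "\<And>k. d' * b k = (\<Sum>\<rho>\<in>S. c' \<rho> * \<rho> ^ k)"
    using assms(2) unfolding exp_sum_on_def by blast
  have eq: "(d * d') * (a k + b k) = (\<Sum>\<rho>\<in>S. (d' * c \<rho> + d * c' \<rho>) * \<rho> ^ k)" for k
  proof -
    have "(d * d') * (a k + b k) = d' * (d * a k) + d * (d' * b k)"
      by (simp add: algebra_simps)
    also have "\<dots> = (\<Sum>\<rho>\<in>S. (d' * c \<rho> + d * c' \<rho>) * \<rho> ^ k)"
      unfolding a b by (simp add: sum_distrib_left sum.distrib algebra_simps)
    finally show ?thesis .
  qed
  have "d * d' \<noteq> 0" using d d' by simp
  then show ?thesis by (rule exp_sum_onI[OF _ eq])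
qed

lemma exp_sum_on_const_mult:
  assumes "exp_sum_on S a"
  shows "exp_sum_on S (\<lambda>k. x * a k)"
proof -
  obtain d c where d: "d \<noteq> 0" and a: "\<And>k. d * a k = (\<Sum>\<rho>\<in>S. c \<rho> * \<rho> ^ k)"
    using assms unfolding exp_sum_on_def by blast
  have eq: "d * (x * a k) = (\<Sum>\<rho>\<in>S. (x * c \<rho>) * \<rho> ^ k)" for k
    using a[of k] by (metis (no_types, lifting) mult.assoc mult.left_commute sum.cong sum_distrib_left)
  show ?thesis by (rule exp_sum_onI[OF d eq])
qed

lemma exp_sum_on_zero: "exp_sum_on S (\<lambda>k. 0)"
  unfolding exp_sum_on_def by (intro exI[of _ 1] exI[of _ "\<lambda>_. 0"]) auto

lemma exp_sum_on_sum:
  assumes "\<And>x. x \<in> A \<Longrightarrow> exp_sum_on S (f x)"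
  shows "exp_sum_on S (\<lambda>k. \<Sum>x\<in>A. f x k)"
  using assms
  by (induction A rule: infinite_finite_induct) (auto intro: exp_sum_on_zero exp_sum_on_add)

lemma exp_sum_add:
  assumes "exp_sum a" "exp_sum b"
  shows "exp_sum (\<lambda>k. a k + b k)"
proof -
  obtain S S' where "finite S" "exp_sum_on S a" "finite S'" "exp_sum_on S' b"
    using assms unfolding exp_sum_def by blast
  then have "exp_sum_on (S \<union> S') (\<lambda>k. a k + b k)"
    by (intro exp_sum_on_add) (auto intro: exp_sum_on_mono)
  with \<open>finite S\<close> \<open>finite S'\<close> show ?thesis
    unfolding exp_sum_def by blast
qed

lemma exp_sum_const: "exp_sum (\<lambda>k. x)"
  unfolding exp_sum_def exp_sum_on_def
  by (intro exI[of _ "{1}"]) (auto intro!: exI[of _ 1] exI[of _ "\<lambda>_. x"])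

lemma exp_sum_sum:
  assumes "\<And>x. x \<in> A \<Longrightarrow> exp_sum (f x)"
  shows "exp_sum (\<lambda>k. \<Sum>x\<in>A. f x k)"
  using assms
  by (induction A rule: infinite_finite_induct) (auto intro: exp_sum_const exp_sum_add)

text \<open>The new roots are the products \<open>\<rho> * \<sigma>\<close>. Different pairs may
  give the same product, so coefficients are collected over the fibres of multiplication and every
  root still occurs once.\<close>

lemma exp_sum_mult:
  assumes "exp_sum a" "exp_sum b"
  shows "exp_sum (\<lambda>k. a k * b k)"
proof -
  obtain S d c where S: "finite S" and d: "d \<noteq> 0"
    and a: "\<And>k. d * a k = (\<Sum>\<rho>\<in>S. c \<rho> * \<rho> ^ k)"
    using assms(1) unfolding exp_sum_def exp_sum_on_def by blast
  obtain S' d' c' where S': "finite S'" and d': "d' \<noteq> 0"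
    and b: "\<And>k. d' * b k = (\<Sum>\<rho>\<in>S'. c' \<rho> * \<rho> ^ k)"
    using assms(2) unfolding exp_sum_def exp_sum_on_def by blast
  let ?m = "\<lambda>(\<rho>, \<sigma>). \<rho> * \<sigma>"
  let ?U = "?m ` (S \<times> S')"
  let ?c = "\<lambda>\<tau>. \<Sum>x\<in>{x \<in> S \<times> S'. ?m x = \<tau>}. c (fst x) * c' (snd x)"
  have eq: "(d * d') * (a k * b k) = (\<Sum>\<tau>\<in>?U. ?c \<tau> * \<tau> ^ k)" for k
  proof -
    have "(d * d') * (a k * b k) = (d * a k) * (d' * b k)"
      by (simp add: algebra_simps)
    also have "\<dots> = (\<Sum>x\<in>S \<times> S'. c (fst x) * c' (snd x) * ?m x ^ k)"
      unfolding a b sum_product sum.cartesian_product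
      by (intro sum.cong) (auto simp: power_mult_distrib algebra_simps)
    also have "\<dots> = (\<Sum>\<tau>\<in>?U. \<Sum>x\<in>{x \<in> S \<times> S'. ?m x = \<tau>}. c (fst x) * c' (snd x) * ?m x ^ k)"
      using S S' by (intro sum.image_gen) auto
    also have "\<dots> = (\<Sum>\<tau>\<in>?U. ?c \<tau> * \<tau> ^ k)"
      unfolding sum_distrib_right by (intro sum.cong) auto
    finally show ?thesis .
  qed
  have "d * d' \<noteq> 0" "finite ?U" using d d' S S' by auto
  then have "exp_sum_on ?U (\<lambda>k. a k * b k)" by (intro exp_sum_onI[OF _ eq])
  with \<open>finite ?U\<close> show ?thesis
    unfolding exp_sum_def by blast
qed

text \<open>
  Partial fractions: the forced response to \<open>\<rho> ^ k\<close> is \<open>\<rho> ^ k / (\<rho> - \<mu>)\<close>, which needs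
  \<open>\<mu>\<close> not to resonate with any \<open>\<rho> \<in> S\<close>.
\<close>

lemma exp_sum_on_step:
  assumes "exp_sum_on S b" "finite S" "\<mu> \<notin> S" and rec: "\<And>k. a (Suc k) = \<mu> * a k + b k"
  shows "exp_sum_on (insert \<mu> S) a"
proof -
  obtain d c where d: "d \<noteq> 0" and b: "\<And>k. d * b k = (\<Sum>\<rho>\<in>S. c \<rho> * \<rho> ^ k)"
    using assms(1) unfolding exp_sum_on_def by blast
  \<comment> \<open>\<open>D\<close> clears the denominators \<open>\<rho> - \<mu>\<close>: the
    quotient of \<open>e \<rho>\<close> by \<open>D\<close> stands for
    \<open>c \<rho> / (\<rho> - \<mu>)\<close>, the coefficient of the forced response. The
    homogeneous part \<open>f * \<mu> ^ k\<close> is fitted to the value at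
    \<open>0\<close>.\<close>
  define D where "D = (\<Prod>\<rho>\<in>S. \<rho> - \<mu>)"
  define e where "e \<rho> = c \<rho> * (\<Prod>\<sigma>\<in>S - {\<rho>}. \<sigma> - \<mu>)" for \<rho>
  define f where "f = D * d * a 0 - (\<Sum>\<rho>\<in>S. e \<rho>)"
  have e: "e \<rho> * (\<rho> - \<mu>) = c \<rho> * D" if "\<rho> \<in> S" for \<rho>
    unfolding e_def D_def using that \<open>finite S\<close> by (simp add: prod.remove algebra_simps)
  have D: "D \<noteq> 0"
    unfolding D_def using assms(2,3) by auto
  have main: "D * d * a k = (\<Sum>\<rho>\<in>S. e \<rho> * \<rho> ^ k) + f * \<mu> ^ k" for k
  proof (induction k)
    case 0
    show ?case by (simp add: f_def)
  next
    case (Suc k)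
    have "D * d * a (Suc k) = \<mu> * (D * d * a k) + D * (d * b k)"
      by (simp add: rec algebra_simps)
    also have "\<dots> = (\<Sum>\<rho>\<in>S. \<mu> * (e \<rho> * \<rho> ^ k) + c \<rho> * D * \<rho> ^ k) + f * \<mu> ^ Suc k"
      unfolding Suc b by (simp add: sum.distrib sum_distrib_left algebra_simps)
    also have "(\<Sum>\<rho>\<in>S. \<mu> * (e \<rho> * \<rho> ^ k) + c \<rho> * D * \<rho> ^ k) = (\<Sum>\<rho>\<in>S. e \<rho> * \<rho> ^ Suc k)"
    proof (rule sum.cong[OF refl])
      fix \<rho> assume "\<rho> \<in> S"
      show "\<mu> * (e \<rho> * \<rho> ^ k) + c \<rho> * D * \<rho> ^ k = e \<rho> * \<rho> ^ Suc k"
        unfolding e[OF \<open>\<rho> \<in> S\<close>, symmetric] by (simp add: algebra_simps)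
    qed
    finally show ?case .
  qed
  have eq: "D * d * a k = (\<Sum>\<rho>\<in>insert \<mu> S. (e(\<mu> := f)) \<rho> * \<rho> ^ k)" for k
  proof -
    have "(\<Sum>\<rho>\<in>S. (e(\<mu> := f)) \<rho> * \<rho> ^ k) = (\<Sum>\<rho>\<in>S. e \<rho> * \<rho> ^ k)"
      using \<open>\<mu> \<notin> S\<close> by (intro sum.cong) auto
    then show ?thesis
      unfolding main using assms(2,3) by simp
  qed
  have "D * d \<noteq> 0" using D d by simp
  then show ?thesis by (rule exp_sum_onI[OF _ eq])
qed

text \<open>The product of all \<open>u - \<rho>\<close> annihilates every geometric sequence
  \<open>\<rho> ^ k\<close> with \<open>\<rho> \<in> S\<close>, and the denominator cancels in an
  integral domain. The shift by \<open>Suc\<close> matches sequences indexed from \<open>1\<close>: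
  only their values from there on need to be an exponential sum.\<close>

lemma exp_sum_imp_recurrence:
  assumes "exp_sum (\<lambda>k. a (Suc k))"
  shows "\<exists>p. satisfies_recurrence a p \<and> simple_roots p"
proof -
  obtain S d c where S: "finite S" and d: "d \<noteq> 0"
    and a: "\<And>k. d * a (Suc k) = (\<Sum>\<rho>\<in>S. c \<rho> * \<rho> ^ k)"
    using assms unfolding exp_sum_def exp_sum_on_def by blast
  define p where "p = (\<Prod>\<rho>\<in>S. [:- \<rho>, 1:])"
  have lead: "lead_coeff p = 1"
    unfolding p_def lead_coeff_prod by simp
  have root: "poly p \<rho> = 0" if "\<rho> \<in> S" for \<rho>
    unfolding p_def poly_prod using S that by (auto intro!: bexI[of _ \<rho>])
  have rev: "(\<Sum>i\<le>degree p. coeff p (degree p - i) * \<rho> ^ (degree p - i)) = poly p \<rho>" for \<rho>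
    unfolding poly_altdef by (rule sum.reindex_bij_witness[of _ "\<lambda>i. degree p - i" "\<lambda>i. degree p - i"]) auto
  have "(\<Sum>i\<le>degree p. coeff p (degree p - i) * a (k - i)) = 0" if k: "k \<ge> degree p + 1" for k
  proof -
    \<comment> \<open>For \<open>i \<le> degree p\<close> the index \<open>k - i\<close> is
      \<open>Suc (l + (degree p - i))\<close>. The common factor \<open>\<rho> ^ l\<close> therefore
      splits off, and what remains sums to \<open>poly p \<rho>\<close>.\<close>
    define l where "l = k - Suc (degree p)"
    have pow: "d * a (k - i) = (\<Sum>\<rho>\<in>S. c \<rho> * (\<rho> ^ l * \<rho> ^ (degree p - i)))" if "i \<le> degree p" for i
    proof -
      have "k - i = Suc (l + (degree p - i))"
        using that k by (auto simp: l_def)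
      then show ?thesis
        by (simp add: a power_add)
    qed
    have "d * (\<Sum>i\<le>degree p. coeff p (degree p - i) * a (k - i))
        = (\<Sum>i\<le>degree p. coeff p (degree p - i) * (d * a (k - i)))"
      by (simp add: sum_distrib_left mult.left_commute)
    also have "\<dots> = (\<Sum>i\<le>degree p. \<Sum>\<rho>\<in>S. c \<rho> * \<rho> ^ l * (coeff p (degree p - i) * \<rho> ^ (degree p - i)))"
      by (intro sum.cong refl) (simp add: pow sum_distrib_left algebra_simps)
    also have "\<dots> = (\<Sum>\<rho>\<in>S. c \<rho> * \<rho> ^ l * poly p \<rho>)"
      by (subst sum.swap) (simp add: rev[symmetric] sum_distrib_left)
    also have "\<dots> = 0" by (simp add: root)
    finally show ?thesis using d by simp
  qed
  with lead have "satisfies_recurrence a p"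
    unfolding satisfies_recurrence_def by blast
  moreover have "simple_roots p"
    unfolding simple_roots_def p_def using S by blast
  ultimately show ?thesis by blast
qed

section \<open>Transfer matrices\<close>

text \<open>This is the entry at \<open>(s, u)\<close> of the product of the matrices
  \<open>W j\<close>, ..., \<open>W (j + l - 1)\<close>, that is, the total weight of the walks of
  length \<open>l\<close> from \<open>s\<close> to \<open>u\<close> that begin at column
  \<open>j\<close>. The state sets depend on the column because the rows end at different
  columns.\<close>

fun path_sum :: "(nat \<Rightarrow> 's set) \<Rightarrow> (nat \<Rightarrow> 's \<Rightarrow> 's \<Rightarrow> 'a::comm_semiring_1) \<Rightarrow>
    nat \<Rightarrow> nat \<Rightarrow> 's \<Rightarrow> 's \<Rightarrow> 'a" where
  "path_sum V W j 0 s u = of_bool (s = u)"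
| "path_sum V W j (Suc l) s u = (\<Sum>v\<in>V (j + l). path_sum V W j l s v * W (j + l) v u)"

text \<open>This is associativity of the matrix product. The end \<open>u\<close> has to be a state:
  for \<open>l' = 0\<close> the sum on the right sees only states.\<close>

lemma path_sum_add:
  assumes "finite (V (j + l))" "u \<in> V (j + l + l')"
  shows "path_sum V W j (l + l') s u
    = (\<Sum>v\<in>V (j + l). path_sum V W j l s v * path_sum V W (j + l) l' v u)"
  using assms(2)
proof (induction l' arbitrary: u)
  case 0
  then show ?case using assms(1) by (simp add: of_bool_def if_distrib sum.delta' cong: if_cong)
next
  case (Suc l')
  have "path_sum V W j (l + Suc l') s u
      = (\<Sum>x\<in>V (j + l + l'). (\<Sum>v\<in>V (j + l). path_sum V W j l s v * path_sum V W (j + l) l' v x)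
          * W (j + l + l') x u)"
    by (simp add: Suc.IH add.assoc)
  also have "\<dots> = (\<Sum>v\<in>V (j + l). path_sum V W j l s v * path_sum V W (j + l) (Suc l') v u)"
    by (simp add: sum_distrib_left sum_distrib_right mult.assoc) (rule sum.swap)
  finally show ?case .
qed

lemma sum_of_bool_mult:
  fixes g :: "'b \<Rightarrow> 'a::comm_semiring_1"
  assumes "finite A" "s \<in> A"
  shows "(\<Sum>u\<in>A. of_bool (s = u) * g u) = g s"
  using assms by (subst sum.remove[of A s]) (auto intro!: sum.neutral)

text \<open>The transfer matrix method: summing over explicit walks gives entries of a matrix
  product. The end weight \<open>g\<close> is arbitrary so that the induction can absorb the last
  step into it.\<close>

lemma sum_paths:
  assumes fin: "\<And>j. finite (V j)" and "s \<in> V 0"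
  shows "(\<Sum>p\<in>{p \<in> PiE {..N} V. p 0 = s}. (\<Prod>j<N. W j (p j) (p (Suc j))) * g (p N))
    = (\<Sum>u\<in>V N. path_sum V W 0 N s u * g u)"
proof (induction N arbitrary: g)
  case 0
  have "{p \<in> PiE {..0} V. p 0 = s} = {\<lambda>j\<in>{0}. s}"
    using assms(2) by (auto simp: PiE_iff extensional_def fun_eq_iff)
  then show ?case
    using assms by (simp add: sum_of_bool_mult)
next
  case (Suc N)
  let ?P = "{p \<in> PiE {..N} V. p 0 = s}"
  let ?e = "\<lambda>(y, q). q(Suc N := y)"
  have P: "{p \<in> PiE {..Suc N} V. p 0 = s} = ?e ` (V (Suc N) \<times> ?P)"
    unfolding atMost_Suc PiE_insert_eq by (auto simp: image_iff)
  have inj: "inj_on ?e (V (Suc N) \<times> ?P)"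
    by (rule inj_on_subset[OF inj_combinator[of "Suc N" "{..N}" V]]) auto
  have "(\<Sum>p\<in>{p \<in> PiE {..Suc N} V. p 0 = s}. (\<Prod>j<Suc N. W j (p j) (p (Suc j))) * g (p (Suc N)))
     = (\<Sum>(y, q)\<in>V (Suc N) \<times> ?P. (\<Prod>j<N. W j (q j) (q (Suc j))) * W N (q N) y * g y)"
    unfolding P sum.reindex[OF inj] by (intro sum.cong) (auto intro!: prod.cong)
  also have "\<dots> = (\<Sum>q\<in>?P. (\<Prod>j<N. W j (q j) (q (Suc j))) * (\<Sum>y\<in>V (Suc N). W N (q N) y * g y))"
    unfolding sum.cartesian_product[symmetric] sum_distrib_left
    by (subst sum.swap) (simp add: mult.assoc)
  also have "\<dots> = (\<Sum>u\<in>V N. path_sum V W 0 N s u * (\<Sum>y\<in>V (Suc N). W N u y * g y))"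
    by (rule Suc)
  also have "\<dots> = (\<Sum>u\<in>V (Suc N). path_sum V W 0 (Suc N) s u * g u)"
    unfolding sum_distrib_left path_sum.simps sum_distrib_right add_0
    by (subst sum.swap) (simp add: mult.assoc)
  finally show ?case .
qed

text \<open>
  A triangular matrix has distinct eigenvalues along every descending chain, so its powers
  involve no polynomial factors in \<open>k\<close>.
\<close>

lemma exp_sum_on_path_sum:
  fixes w :: "'s \<Rightarrow> 's \<Rightarrow> 'a::idom" and \<kappa> :: "'s \<Rightarrow> nat"
  assumes fin: "finite U"
    and tri: "\<And>s v. s \<in> U \<Longrightarrow> v \<in> U \<Longrightarrow> w s v \<noteq> 0 \<Longrightarrow> s \<noteq> v \<Longrightarrow> \<kappa> v < \<kappa> s"
    and dist: "\<And>s v. s \<in> U \<Longrightarrow> v \<in> U \<Longrightarrow> w s s = w v v \<Longrightarrow> \<kappa> s = \<kappa> v"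
    and "s \<in> U" "u \<in> U"
  shows "exp_sum_on (insert (w s s) {w v v | v. v \<in> U \<and> \<kappa> v < \<kappa> s})
    (\<lambda>k. path_sum (\<lambda>_. U) (\<lambda>_. w) 0 k s u)"
  using \<open>s \<in> U\<close>
proof (induction "\<kappa> s" arbitrary: s rule: less_induct)
  case less
  let ?a = "\<lambda>s k. path_sum (\<lambda>_. U) (\<lambda>_. w) 0 k s u"
  let ?S = "\<lambda>s. {w v v | v. v \<in> U \<and> \<kappa> v < \<kappa> s}"
  have finS: "finite (?S s)" for s
    using fin by (auto intro: finite_subset[of _ "(\<lambda>v. w v v) ` U"])
  have shift: "path_sum (\<lambda>_. U) (\<lambda>_. w) j k x y = path_sum (\<lambda>_. U) (\<lambda>_. w) 0 k x y" for j k x y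
    by (induction k arbitrary: y) auto
  have one: "path_sum (\<lambda>_. U) (\<lambda>_. w) 0 1 x y = w x y" if "x \<in> U" for x y
    using that fin by (simp add: sum_of_bool_mult)
  \<comment> \<open>Here the first step is split off, whereas \<open>path_sum\<close> splits off the
    last one. The end \<open>u\<close> stays fixed and the start moves to states of smaller
    \<open>\<kappa>\<close>, to which the induction hypothesis applies.\<close>
  have rec: "?a s (Suc k) = w s s * ?a s k + (\<Sum>v\<in>U - {s}. w s v * ?a v k)" for k
  proof -
    have "?a s (Suc k) = (\<Sum>v\<in>U. w s v * ?a v k)"
      using path_sum_add[of "\<lambda>_. U" 0 1 u k "\<lambda>_. w" s] fin \<open>u \<in> U\<close>
        one[OF \<open>s \<in> U\<close>] shift[of 1] by simp
    also have "\<dots> = w s s * ?a s k + (\<Sum>v\<in>U - {s}. w s v * ?a v k)"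
      using fin less.prems by (simp add: sum.remove)
    finally show ?thesis .
  qed
  have forced: "exp_sum_on (?S s) (\<lambda>k. \<Sum>v\<in>U - {s}. w s v * ?a v k)"
  proof (rule exp_sum_on_sum)
    fix v assume v: "v \<in> U - {s}"
    show "exp_sum_on (?S s) (\<lambda>k. w s v * ?a v k)"
    proof (cases "w s v = 0")
      case True
      then show ?thesis by (simp add: exp_sum_on_zero)
    next
      case False
      then have lt: "\<kappa> v < \<kappa> s" using tri v less.prems by auto
      have "exp_sum_on (?S s) (?a v)"
        using v lt finS by (intro exp_sum_on_mono[OF less.hyps[OF lt]]) auto
      then show ?thesis by (rule exp_sum_on_const_mult)
    qed
  qed
  have nonres: "w s s \<notin> ?S s"
  proof
    assume "w s s \<in> ?S s"
    then obtain v where "w s s = w v v" "v \<in> U" "\<kappa> v < \<kappa> s" by blast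
    with dist[OF less.prems] show False by (metis less_irrefl)
  qed
  show ?case
    using exp_sum_on_step[OF forced finS nonres rec] .
qed

text \<open>
  Columns are grouped into blocks of equal length \<open>Suc m\<close>; \<open>(j + m) div Suc m\<close> is
  \<open>j / Suc m\<close> rounded up, so that block \<open>c \<ge> 1\<close> ends with column \<open>c * Suc m\<close>.
\<close>

lemma exp_sum_block_path_sum:
  fixes w :: "nat \<Rightarrow> nat \<Rightarrow> 's \<Rightarrow> 's \<Rightarrow> 'a::idom" and \<kappa> :: "nat \<Rightarrow> 's \<Rightarrow> nat"
  defines "blk \<equiv> \<lambda>m j. (j + m) div Suc m"
  assumes fin: "\<And>c. finite (U c)"
    and tri: "\<And>c s v. s \<in> U c \<Longrightarrow> v \<in> U c \<Longrightarrow> w c c s v \<noteq> 0 \<Longrightarrow> s \<noteq> v \<Longrightarrow> \<kappa> c v < \<kappa> c s"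
    and dist: "\<And>c s v. s \<in> U c \<Longrightarrow> v \<in> U c \<Longrightarrow> w c c s s = w c c v v \<Longrightarrow> \<kappa> c s = \<kappa> c v"
    and "u \<in> U c"
  shows "exp_sum (\<lambda>m. path_sum (\<lambda>j. U (blk m j)) (\<lambda>j. w (blk m j) (blk m (Suc j))) 0 (c * Suc m) s u)"
  using \<open>u \<in> U c\<close>
proof (induction c arbitrary: u)
  \<comment> \<open>Block \<open>0\<close> is the basement column alone, so the walk has length
    \<open>0\<close> for every \<open>m\<close>.\<close>
  case 0
  show ?case by (simp add: exp_sum_const)
next
  case (Suc c)
  let ?V = "\<lambda>m j. U (blk m j)" and ?W = "\<lambda>m j. w (blk m j) (blk m (Suc j))"
  have ceil: "(c * Suc m + i) div Suc m = c + i div Suc m" for c m i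
    by (rule div_mult_self3) simp
  have blk_end: "blk m (c * Suc m) = c" for m
    unfolding blk_def ceil by simp
  have blk_in: "blk m (c * Suc m + Suc i) = Suc c" if "i \<le> m" for m i
  proof -
    have "(Suc i + m) div Suc m = 1"
      using that by (intro div_nat_eqI) auto
    then show ?thesis
      unfolding blk_def add.assoc ceil by (simp only: Suc_eq_plus1)
  qed
  let ?w = "w (Suc c) (Suc c)" and ?U = "U (Suc c)"
  \<comment> \<open>A walk to the end of block \<open>Suc c\<close> consists of a walk to the end of
    block \<open>c\<close>, one step across the boundary, and \<open>m\<close> steps inside the new
    block. Only the last part is a power of a fixed matrix; the boundary step does not depend on
    \<open>m\<close>.\<close>
  have split: "path_sum (?V m) (?W m) 0 (Suc c * Suc m) s u
      = (\<Sum>v\<in>?U. (\<Sum>x\<in>U c. path_sum (?V m) (?W m) 0 (c * Suc m) s x * w c (Suc c) x v)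
          * path_sum (\<lambda>_. ?U) (\<lambda>_. ?w) 0 m v u)" for m
  proof -
    define e where "e = c * Suc m"
    have len: "Suc c * Suc m = Suc e + m"
      by (simp add: e_def)
    have blk_e: "blk m e = c" and blk_Suc_e: "\<And>i. i \<le> m \<Longrightarrow> blk m (Suc (e + i)) = Suc c"
      using blk_end[of m] blk_in[of _ m] unfolding e_def by simp_all
    have inner: "path_sum (?V m) (?W m) (Suc e) l x y = path_sum (\<lambda>_. ?U) (\<lambda>_. ?w) 0 l x y"
      if "l \<le> m" for l x y
      using that
    proof (induction l arbitrary: y)
      case (Suc l)
      then show ?case
        using blk_Suc_e[of l] blk_Suc_e[of "Suc l"] by simp
    qed simp
    have "path_sum (?V m) (?W m) 0 (Suc e + m) s u
        = (\<Sum>v\<in>?V m (0 + Suc e). path_sum (?V m) (?W m) 0 (Suc e) s v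
            * path_sum (?V m) (?W m) (0 + Suc e) m v u)"
      using fin Suc.prems blk_Suc_e[of m] by (intro path_sum_add) auto
    then show ?thesis
      unfolding len e_def[symmetric] using blk_Suc_e[of 0] blk_e inner[of m] by simp
  qed
  have "exp_sum (\<lambda>m. path_sum (\<lambda>_. ?U) (\<lambda>_. ?w) 0 m v u)" if "v \<in> ?U" for v
  proof -
    have "finite (insert (?w v v) {?w x x | x. x \<in> ?U \<and> \<kappa> (Suc c) x < \<kappa> (Suc c) v})"
      using fin[of "Suc c"] by simp
    then show ?thesis
      unfolding exp_sum_def
      using exp_sum_on_path_sum[of ?U ?w "\<kappa> (Suc c)" v u, OF fin tri dist that Suc.prems] by blast
  qed
  then show ?case
    unfolding split by (intro exp_sum_sum exp_sum_mult Suc.IH exp_sum_const)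
qed

section \<open>Fillings as sequences of columns\<close>

definition rows :: "nat \<Rightarrow> (nat \<Rightarrow> nat) \<Rightarrow> nat \<Rightarrow> nat set" where
  "rows n \<gamma> j = {i \<in> {1..n}. j \<le> \<gamma> i}"

definition col :: "nat \<Rightarrow> (nat \<Rightarrow> nat) \<Rightarrow> filling \<Rightarrow> nat \<Rightarrow> nat \<Rightarrow> nat" where
  "col n \<gamma> T j = restrict (\<lambda>i. T (i, j)) (rows n \<gamma> j)"

text \<open>The bound \<open>B\<close> makes the set of columns finite. One bound serves all stretch
  factors, since weakly decreasing rows never exceed the basement.\<close>

definition states :: "nat \<Rightarrow> nat set \<Rightarrow> (nat \<Rightarrow> nat) set" where
  "states B A = {s \<in> A \<rightarrow>\<^sub>E {1..B}. inj_on s A}"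

lemma finite_rows [simp]: "finite (rows n \<gamma> j)"
  by (simp add: rows_def)

lemma finite_states [simp]: "finite A \<Longrightarrow> finite (states B A)"
  unfolding states_def by (rule finite_subset[OF _ finite_PiE[of A "\<lambda>_. {1..B}"]]) auto

lemma rows_SucD: "i \<in> rows n \<gamma> (Suc j) \<Longrightarrow> i \<in> rows n \<gamma> j"
  by (simp add: rows_def)

lemma mem_aug_boxes: "(i, j) \<in> aug_boxes n \<gamma> \<longleftrightarrow> i \<in> rows n \<gamma> j"
  by (auto simp: aug_boxes_def rows_def)

lemma col_apply [simp]: "i \<in> rows n \<gamma> j \<Longrightarrow> col n \<gamma> T j i = T (i, j)"
  by (simp add: col_def)

lemma col_apply_Suc [simp]: "i \<in> rows n \<gamma> (Suc j) \<Longrightarrow> col n \<gamma> T j i = T (i, j)"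
  by (simp add: col_def rows_def)

lemma mem_rows_le:
  assumes "\<forall>i\<in>{1..n}. \<gamma> i \<le> N" "i \<in> rows n \<gamma> j"
  shows "j \<le> N"
proof -
  have "j \<le> \<gamma> i" "i \<in> {1..n}" using assms(2) by (simp_all add: rows_def)
  with assms(1) show ?thesis by (metis order_trans)
qed

text \<open>A row of length \<open>a\<close> reaches column \<open>j\<close> after stretching
  exactly if \<open>j / Suc m\<close>, rounded up, is at most \<open>a\<close>. So the columns of
  one block all have the rows of one column of the original shape.\<close>

lemma rows_stretch: "rows n (\<lambda>i. Suc m * \<alpha> i) j = rows n \<alpha> ((j + m) div Suc m)"
proof -
  have "j \<le> Suc m * a \<longleftrightarrow> (j + m) div Suc m \<le> a" for a
  proof -
    have "(j + m) div Suc m \<le> a \<longleftrightarrow> (j + m) div Suc m < Suc a" by auto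
    also have "\<dots> \<longleftrightarrow> j + m < Suc a * Suc m" by (rule div_less_iff_less_mult) simp
    also have "\<dots> \<longleftrightarrow> j \<le> Suc m * a" by (auto simp: algebra_simps)
    finally show ?thesis by simp
  qed
  then show ?thesis unfolding rows_def by blast
qed

text \<open>A filling is the same as the sequence of its columns, a walk that starts at the
  basement. The product of the step weights vanishes on fillings outside \<open>X\<close>, so the
  steps themselves enforce membership in \<open>X\<close>.\<close>

lemma sum_fillings_eq_path_sum:
  fixes f :: "filling \<Rightarrow> 'a::comm_semiring_1"
  assumes N: "\<forall>i\<in>{1..n}. \<gamma> i \<le> N"
    and X: "X \<subseteq> aug_fillings n \<beta> \<gamma>"
    and st: "\<And>T j. T \<in> X \<Longrightarrow> j \<le> N \<Longrightarrow> col n \<gamma> T j \<in> states B (rows n \<gamma> j)"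
    and wt: "\<And>T. T \<in> aug_fillings n \<beta> \<gamma> \<Longrightarrow> \<forall>j\<le>N. col n \<gamma> T j \<in> states B (rows n \<gamma> j) \<Longrightarrow>
      (if T \<in> X then f T else 0) = (\<Prod>j<N. W j (col n \<gamma> T j) (col n \<gamma> T (Suc j)))"
    and base: "restrict \<beta> {1..n} \<in> states B {1..n}"
  shows "sum f X = (\<Sum>u\<in>states B (rows n \<gamma> N).
    path_sum (\<lambda>j. states B (rows n \<gamma> j)) W 0 N (restrict \<beta> {1..n}) u)"
proof -
  let ?V = "\<lambda>j. states B (rows n \<gamma> j)"
  define Y where "Y = {T \<in> aug_fillings n \<beta> \<gamma>. \<forall>j\<le>N. col n \<gamma> T j \<in> ?V j}"
  define P where "P = {p \<in> PiE {..N} ?V. p 0 = restrict \<beta> {1..n}}"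
  define \<phi> where "\<phi> T = (\<lambda>j\<in>{..N}. col n \<gamma> T j)" for T
  define \<psi> where "\<psi> p = (\<lambda>(i, j)\<in>aug_boxes n \<gamma>. p j i)" for p :: "nat \<Rightarrow> nat \<Rightarrow> nat"
  have rows0: "rows n \<gamma> 0 = {1..n}" by (auto simp: rows_def)
  have le_N: "j \<le> N" if "i \<in> rows n \<gamma> j" for i j
    by (rule mem_rows_le[OF N that])
  have \<psi>_apply: "\<psi> p (i, j) = p j i" if "i \<in> rows n \<gamma> j" for p i j
    using that by (simp add: \<psi>_def mem_aug_boxes)
  have col\<psi>: "col n \<gamma> (\<psi> p) j = p j" if "p \<in> P" "j \<le> N" for p j
  proof -
    have "p j \<in> extensional (rows n \<gamma> j)"
      using that by (auto simp: P_def states_def PiE_iff)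
    then show ?thesis
      by (auto simp: col_def fun_eq_iff \<psi>_apply extensional_def)
  qed
  have bij: "bij_betw \<phi> Y P"
  proof (rule bij_betw_byWitness[where f' = \<psi>])
    show "\<forall>T\<in>Y. \<psi> (\<phi> T) = T"
    proof
      fix T assume "T \<in> Y"
      then have ext: "T \<in> extensional (aug_boxes n \<gamma>)"
        by (auto simp: Y_def aug_fillings_def PiE_iff)
      have "\<psi> (\<phi> T) (i, j) = T (i, j)" for i j
        using ext le_N[of i j]
        by (cases "i \<in> rows n \<gamma> j") (auto simp: \<psi>_def \<phi>_def mem_aug_boxes extensional_def)
      then show "\<psi> (\<phi> T) = T" by auto
    qed
    show "\<forall>p\<in>P. \<phi> (\<psi> p) = p"
    proof
      fix p assume "p \<in> P"
      then have "p \<in> extensional {..N}" by (auto simp: P_def PiE_iff)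
      with col\<psi>[OF \<open>p \<in> P\<close>] show "\<phi> (\<psi> p) = p"
        by (auto simp: \<phi>_def fun_eq_iff extensional_def)
    qed
    show "\<phi> ` Y \<subseteq> P"
    proof
      fix p assume "p \<in> \<phi> ` Y"
      then obtain T where T: "T \<in> Y" "p = \<phi> T" by blast
      then have "col n \<gamma> T 0 = restrict \<beta> {1..n}"
        unfolding col_def rows0 by (intro restrict_ext) (auto simp: Y_def aug_fillings_def)
      with T show "p \<in> P"
        by (auto simp: P_def Y_def \<phi>_def)
    qed
    show "\<psi> ` P \<subseteq> Y"
    proof
      fix T assume "T \<in> \<psi> ` P"
      then obtain p where p: "p \<in> P" "T = \<psi> p" by blast
      have "T (i, j) > 0" if "i \<in> rows n \<gamma> j" for i j
      proof -
        have "p j \<in> ?V j"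
          using p(1) le_N[OF that] by (auto simp: P_def)
        then show ?thesis
          using that by (fastforce simp: p(2) \<psi>_apply states_def PiE_iff)
      qed
      moreover have "T (i, 0) = \<beta> i" if "i \<in> {1..n}" for i
        using that p by (simp add: \<psi>_apply rows0 P_def)
      ultimately have "T \<in> aug_fillings n \<beta> \<gamma>"
        by (auto simp: aug_fillings_def PiE_iff mem_aug_boxes) (simp add: p(2) \<psi>_def)
      moreover have "col n \<gamma> T j \<in> ?V j" if "j \<le> N" for j
        using col\<psi>[OF p(1) that] p that by (auto simp: P_def)
      ultimately show "T \<in> Y" by (simp add: Y_def)
    qed
  qed
  have "finite (PiE {..N} ?V)"
    by (rule finite_PiE) auto
  then have "finite P" by (auto simp: P_def)
  then have finY: "finite Y" using bij bij_betw_finite by blast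
  have "X \<subseteq> Y" using X st by (auto simp: Y_def)
  \<comment> \<open>Extension by zero to all fillings whose columns are states; these correspond
    bijectively to the walks in \<open>P\<close>.\<close>
  then have "sum f X = (\<Sum>T\<in>Y. if T \<in> X then f T else 0)"
    using finY by (simp add: sum.inter_restrict[symmetric] Int_absorb1)
  also have "\<dots> = (\<Sum>T\<in>Y. \<Prod>j<N. W j (\<phi> T j) (\<phi> T (Suc j)))"
  proof (rule sum.cong[OF refl])
    fix T assume "T \<in> Y"
    then have "(if T \<in> X then f T else 0) = (\<Prod>j<N. W j (col n \<gamma> T j) (col n \<gamma> T (Suc j)))"
      by (intro wt) (auto simp: Y_def)
    also have "\<dots> = (\<Prod>j<N. W j (\<phi> T j) (\<phi> T (Suc j)))"
      by (intro prod.cong) (auto simp: \<phi>_def)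
    finally show "(if T \<in> X then f T else 0) = (\<Prod>j<N. W j (\<phi> T j) (\<phi> T (Suc j)))" .
  qed
  also have "\<dots> = (\<Sum>p\<in>P. \<Prod>j<N. W j (p j) (p (Suc j)))"
    by (rule sum.reindex_bij_betw[OF bij])
  also have "\<dots> = (\<Sum>u\<in>?V N. path_sum ?V W 0 N (restrict \<beta> {1..n}) u)"
    using sum_paths[where V = ?V and s = "restrict \<beta> {1..n}" and N = N and W = W and g = "\<lambda>_. 1"] base by (simp add: P_def rows0)
  finally show ?thesis .
qed

lemma decreasing_rows_iff:
  assumes "\<forall>i\<in>{1..n}. \<gamma> i \<le> N"
  shows "decreasing_rows n \<gamma> T \<longleftrightarrow>
    (\<forall>j<N. \<forall>i\<in>rows n \<gamma> (Suc j). col n \<gamma> T (Suc j) i \<le> col n \<gamma> T j i)"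
proof -
  have lt_N: "j < N" if "i \<in> rows n \<gamma> (Suc j)" for i j
    using mem_rows_le[OF assms that] by simp
  have "decreasing_rows n \<gamma> T \<longleftrightarrow> (\<forall>j. \<forall>i\<in>rows n \<gamma> (Suc j). T (i, Suc j) \<le> T (i, j))"
    by (auto simp: decreasing_rows_def rows_def)
  also have "\<dots> \<longleftrightarrow> (\<forall>j<N. \<forall>i\<in>rows n \<gamma> (Suc j). T (i, Suc j) \<le> T (i, j))"
    using lt_N by blast
  finally show ?thesis
    by simp
qed

lemma le_basement:
  assumes "T \<in> aug_fillings n \<beta> \<gamma>" "decreasing_rows n \<gamma> T" "i \<in> rows n \<gamma> j"
  shows "T (i, j) \<le> \<beta> i"
  using assms(3)
proof (induction j)
  case 0
  then show ?case using assms(1) by (auto simp: aug_fillings_def rows_def)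
next
  case (Suc j)
  then have "T (i, Suc j) \<le> T (i, j)"
    using assms(2) by (auto simp: decreasing_rows_def rows_def)
  with Suc.IH[OF rows_SucD[OF Suc.prems]] show ?case by simp
qed

lemma col_mem_states:
  assumes "T \<in> aug_fillings n \<beta> \<gamma>" "decreasing_rows n \<gamma> T"
    and "\<And>i. i \<in> {1..n} \<Longrightarrow> \<beta> i \<le> B"
    and "inj_on (\<lambda>i. T (i, j)) (rows n \<gamma> j)"
  shows "col n \<gamma> T j \<in> states B (rows n \<gamma> j)"
proof -
  have "T (i, j) \<in> {1..B}" if "i \<in> rows n \<gamma> j" for i
  proof -
    have "T (i, j) > 0"
      using assms(1) that by (auto simp: aug_fillings_def PiE_iff mem_aug_boxes)
    moreover have "T (i, j) \<le> B"
      using le_basement[OF assms(1,2) that] assms(3)[of i] that by (auto simp: rows_def)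
    ultimately show ?thesis by simp
  qed
  moreover have "inj_on (col n \<gamma> T j) (rows n \<gamma> j)"
    using assms(4) by (simp add: inj_on_def)
  ultimately show ?thesis
    by (auto simp: states_def col_def)
qed

section \<open>Statistics of adjacent columns\<close>

definition pairs_A :: "(nat \<Rightarrow> nat) \<Rightarrow> nat set \<Rightarrow> (nat \<times> nat) set" where
  "pairs_A \<alpha> A = {(i, i'). i \<in> A \<and> i' \<in> A \<and> i < i' \<and> \<alpha> i' \<le> \<alpha> i}"

text \<open>The third box of a type B triple lies in the left column, so its row ranges over the
  rows \<open>A\<^sub>0\<close> of that column, while \<open>A\<close> holds the rows of the right
  column.\<close>

definition pairs_B :: "(nat \<Rightarrow> nat) \<Rightarrow> nat set \<Rightarrow> nat set \<Rightarrow> (nat \<times> nat) set" where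
  "pairs_B \<alpha> A\<^sub>0 A = {(i, i'). i \<in> A \<and> i' \<in> A\<^sub>0 \<and> i' < i \<and> \<alpha> i' < \<alpha> i}"

definition inv_A :: "(nat \<Rightarrow> nat) \<Rightarrow> (nat \<Rightarrow> nat) \<Rightarrow> nat \<times> nat \<Rightarrow> bool" where
  "inv_A s s' = (\<lambda>(i, i'). s' i' \<le> s i \<and> s' i \<le> s' i')"

definition inv_B :: "(nat \<Rightarrow> nat) \<Rightarrow> (nat \<Rightarrow> nat) \<Rightarrow> nat \<times> nat \<Rightarrow> bool" where
  "inv_B s s' = (\<lambda>(i, i'). s i' \<le> s i \<and> s' i \<le> s i')"

definition triple_A :: "nat \<Rightarrow> nat \<times> nat \<Rightarrow> box \<times> box \<times> box" where
  "triple_A j = (\<lambda>(i, i'). ((i, j), (i, Suc j), (i', Suc j)))"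

definition triple_B :: "nat \<Rightarrow> nat \<times> nat \<Rightarrow> box \<times> box \<times> box" where
  "triple_B j = (\<lambda>(i, i'). ((i, j), (i, Suc j), (i', j)))"

lemma finite_pairs [simp]:
  "finite A \<Longrightarrow> finite (pairs_A \<alpha> A)"
  "finite A\<^sub>0 \<Longrightarrow> finite A \<Longrightarrow> finite (pairs_B \<alpha> A\<^sub>0 A)"
proof -
  have "pairs_A \<alpha> A \<subseteq> A \<times> A" "pairs_B \<alpha> A\<^sub>0 A \<subseteq> A \<times> A\<^sub>0"
    by (auto simp: pairs_A_def pairs_B_def)
  then show "finite A \<Longrightarrow> finite (pairs_A \<alpha> A)"
    "finite A\<^sub>0 \<Longrightarrow> finite A \<Longrightarrow> finite (pairs_B \<alpha> A\<^sub>0 A)"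
    by (meson finite_SigmaI finite_subset)+
qed

lemma triples_A_eq:
  assumes "\<forall>i\<in>{1..n}. \<gamma> i \<le> N"
  shows "triples_A n \<gamma> = (\<Union>j<N. triple_A j ` pairs_A \<gamma> (rows n \<gamma> (Suc j)))"
proof (intro equalityI subsetI)
  fix \<tau> assume "\<tau> \<in> triples_A n \<gamma>"
  then obtain i j i' where \<tau>: "\<tau> = triple_A j (i, i')" "i \<in> rows n \<gamma> (Suc j)" "i' \<in> rows n \<gamma> (Suc j)"
      "i < i'" "\<gamma> i' \<le> \<gamma> i"
    by (auto simp: triples_A_def mem_aug_boxes triple_A_def)
  moreover have "j < N" using mem_rows_le[OF assms \<tau>(2)] by simp
  ultimately show "\<tau> \<in> (\<Union>j<N. triple_A j ` pairs_A \<gamma> (rows n \<gamma> (Suc j)))"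
    by (auto simp: pairs_A_def)
next
  fix \<tau> assume "\<tau> \<in> (\<Union>j<N. triple_A j ` pairs_A \<gamma> (rows n \<gamma> (Suc j)))"
  then show "\<tau> \<in> triples_A n \<gamma>"
    by (auto simp: triples_A_def mem_aug_boxes triple_A_def pairs_A_def intro: rows_SucD)
qed

lemma triples_B_eq:
  assumes "\<forall>i\<in>{1..n}. \<gamma> i \<le> N"
  shows "triples_B n \<gamma> = (\<Union>j<N. triple_B j ` pairs_B \<gamma> (rows n \<gamma> j) (rows n \<gamma> (Suc j)))"
proof (intro equalityI subsetI)
  fix \<tau> assume "\<tau> \<in> triples_B n \<gamma>"
  then obtain i j i' where \<tau>: "\<tau> = triple_B j (i, i')" "i \<in> rows n \<gamma> (Suc j)" "i' \<in> rows n \<gamma> j"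
      "i' < i" "\<gamma> i' < \<gamma> i"
    by (auto simp: triples_B_def mem_aug_boxes triple_B_def)
  moreover have "j < N" using mem_rows_le[OF assms \<tau>(2)] by simp
  ultimately show "\<tau> \<in> (\<Union>j<N. triple_B j ` pairs_B \<gamma> (rows n \<gamma> j) (rows n \<gamma> (Suc j)))"
    by (auto simp: pairs_B_def)
next
  fix \<tau> assume "\<tau> \<in> (\<Union>j<N. triple_B j ` pairs_B \<gamma> (rows n \<gamma> j) (rows n \<gamma> (Suc j)))"
  then show "\<tau> \<in> triples_B n \<gamma>"
    by (auto simp: triples_B_def mem_aug_boxes triple_B_def pairs_B_def intro: rows_SucD)
qed

lemma inversion_triple_A:
  assumes "x \<in> pairs_A \<gamma> (rows n \<gamma> (Suc j))"
  shows "inversion_triple T (triple_A j x) \<longleftrightarrow> inv_A (col n \<gamma> T j) (col n \<gamma> T (Suc j)) x"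
  using assms by (auto simp: pairs_A_def triple_A_def inv_A_def)

lemma inversion_triple_B:
  assumes "x \<in> pairs_B \<gamma> (rows n \<gamma> j) (rows n \<gamma> (Suc j))"
  shows "inversion_triple T (triple_B j x) \<longleftrightarrow> inv_B (col n \<gamma> T j) (col n \<gamma> T (Suc j)) x"
  using assms by (auto simp: pairs_B_def triple_B_def inv_B_def)

section \<open>Conditions and statistics of a single step between adjacent columns\<close>

definition ssaf_step :: "(nat \<Rightarrow> nat) \<Rightarrow> nat set \<Rightarrow> nat set \<Rightarrow> (nat \<Rightarrow> nat) \<Rightarrow> (nat \<Rightarrow> nat) \<Rightarrow> bool" where
  "ssaf_step \<alpha> A\<^sub>0 A s s' \<longleftrightarrow> (\<forall>i\<in>A. s' i \<le> s i) \<and>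
     (\<forall>x\<in>pairs_A \<alpha> A. \<not> inv_A s s' x) \<and> (\<forall>x\<in>pairs_B \<alpha> A\<^sub>0 A. \<not> inv_B s s' x)"

text \<open>Attacks within one column do not appear here: they are already excluded by the
  injectivity built into \<open>states\<close>.\<close>

definition nawf_step :: "nat set \<Rightarrow> nat set \<Rightarrow> (nat \<Rightarrow> nat) \<Rightarrow> (nat \<Rightarrow> nat) \<Rightarrow> bool" where
  "nawf_step A\<^sub>0 A s s' \<longleftrightarrow> (\<forall>i\<in>A. s' i \<le> s i) \<and> (\<forall>i\<in>A\<^sub>0. \<forall>i'\<in>A. i < i' \<longrightarrow> s i \<noteq> s' i')"

definition coinv_step :: "(nat \<Rightarrow> nat) \<Rightarrow> nat set \<Rightarrow> nat set \<Rightarrow> (nat \<Rightarrow> nat) \<Rightarrow> (nat \<Rightarrow> nat) \<Rightarrow> nat" where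
  "coinv_step \<alpha> A\<^sub>0 A s s' =
     card {x \<in> pairs_A \<alpha> A. \<not> inv_A s s' x} + card {x \<in> pairs_B \<alpha> A\<^sub>0 A. \<not> inv_B s s' x}"

definition dn_step :: "nat set \<Rightarrow> (nat \<Rightarrow> nat) \<Rightarrow> (nat \<Rightarrow> nat) \<Rightarrow> nat" where
  "dn_step A s s' = card {i \<in> A. s i \<noteq> s' i}"

definition xmon :: "nat set \<Rightarrow> (nat \<Rightarrow> nat) \<Rightarrow> xpoly" where
  "xmon A s = (\<Prod>i\<in>A. Var (s i))"

lemma SSAF_iff_steps:
  assumes "T \<in> aug_fillings n \<beta> \<gamma>" "\<forall>i\<in>{1..n}. \<gamma> i \<le> N"
  shows "T \<in> SSAF n \<beta> \<gamma> \<longleftrightarrow> (\<forall>j<N. ssaf_step \<gamma> (rows n \<gamma> j) (rows n \<gamma> (Suc j))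
    (col n \<gamma> T j) (col n \<gamma> T (Suc j)))"
proof -
  have "(\<forall>\<tau>\<in>triples n \<gamma>. \<not> inversion_triple T \<tau>) \<longleftrightarrow>
    (\<forall>j<N. (\<forall>x\<in>pairs_A \<gamma> (rows n \<gamma> (Suc j)). \<not> inv_A (col n \<gamma> T j) (col n \<gamma> T (Suc j)) x) \<and>
      (\<forall>x\<in>pairs_B \<gamma> (rows n \<gamma> j) (rows n \<gamma> (Suc j)). \<not> inv_B (col n \<gamma> T j) (col n \<gamma> T (Suc j)) x))"
    unfolding triples_def triples_A_eq[OF assms(2)] triples_B_eq[OF assms(2)]
    by (simp add: ball_Un inversion_triple_A inversion_triple_B) blast
  then show ?thesis
    using assms(1) unfolding SSAF_def ssaf_step_def decreasing_rows_iff[OF assms(2)] by blast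
qed

lemma NAWF_iff_steps:
  assumes "T \<in> aug_fillings n (\<lambda>i. i) \<gamma>" "\<forall>i\<in>{1..n}. \<gamma> i \<le> N"
    and st: "\<forall>j\<le>N. col n \<gamma> T j \<in> states B (rows n \<gamma> j)"
  shows "T \<in> NAWF n \<gamma> \<longleftrightarrow> (\<forall>j<N. nawf_step (rows n \<gamma> j) (rows n \<gamma> (Suc j))
    (col n \<gamma> T j) (col n \<gamma> T (Suc j)))"
proof -
  have le_N: "j \<le> N" if "i \<in> rows n \<gamma> j" for i j
    by (rule mem_rows_le[OF assms(2) that])
  have inj: "T (i, j) \<noteq> T (i', j)" if "i \<in> rows n \<gamma> j" "i' \<in> rows n \<gamma> j" "i \<noteq> i'" for i i' j
  proof -
    have "inj_on (col n \<gamma> T j) (rows n \<gamma> j)"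
      using st le_N[OF that(1)] by (auto simp: states_def)
    from inj_onD[OF this] that show ?thesis by auto
  qed
  have "non_attacking n \<gamma> T \<longleftrightarrow> (\<forall>j. \<forall>i\<in>rows n \<gamma> j. \<forall>i'\<in>rows n \<gamma> (Suc j). i < i' \<longrightarrow> T (i, j) \<noteq> T (i', Suc j))"
    (is "?L \<longleftrightarrow> ?R")
  proof
    assume ?L
    show ?R
    proof (intro allI ballI impI)
      fix j i i' assume a: "i \<in> rows n \<gamma> j" "i' \<in> rows n \<gamma> (Suc j)" "i < i'"
      with \<open>?L\<close> have "\<not> attacking T (i, j) (i', Suc j)"
        by (simp add: non_attacking_def mem_aug_boxes)
      with a show "T (i, j) \<noteq> T (i', Suc j)"
        by (simp add: attacking_def)
    qed
  next
    assume ?R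
    show ?L
      unfolding non_attacking_def
    proof (intro ballI notI)
      fix a b assume a: "a \<in> aug_boxes n \<gamma>" and b: "b \<in> aug_boxes n \<gamma>" and "attacking T a b"
      obtain i j where ij: "a = (i, j)" by force
      obtain i' j' where ij': "b = (i', j')" by force
      have "i \<in> rows n \<gamma> j" "i' \<in> rows n \<gamma> j'"
        using a b ij ij' by (simp_all add: mem_aug_boxes)
      then show False
        using \<open>attacking T a b\<close> \<open>?R\<close> inj unfolding attacking_def ij ij' by force
    qed
  qed
  also have "\<dots> \<longleftrightarrow> (\<forall>j<N. \<forall>i\<in>rows n \<gamma> j. \<forall>i'\<in>rows n \<gamma> (Suc j). i < i' \<longrightarrow> T (i, j) \<noteq> T (i', Suc j))"
    using le_N by (meson Suc_le_eq)
  also have "\<dots> \<longleftrightarrow> (\<forall>j<N. \<forall>i\<in>rows n \<gamma> j. \<forall>i'\<in>rows n \<gamma> (Suc j). i < i' \<longrightarrow>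
      col n \<gamma> T j i \<noteq> col n \<gamma> T (Suc j) i')"
    by simp
  finally show ?thesis
    using assms(1) unfolding NAWF_def nawf_step_def decreasing_rows_iff[OF assms(2)] by blast
qed

text \<open>The counts add up because no triple is counted twice: its first box reveals the column
  \<open>j\<close>, and the column of its third box reveals the type.\<close>

lemma coinv_eq_sum:
  assumes "\<forall>i\<in>{1..n}. \<gamma> i \<le> N"
  shows "coinv n \<gamma> T = (\<Sum>j<N. coinv_step \<gamma> (rows n \<gamma> j) (rows n \<gamma> (Suc j))
    (col n \<gamma> T j) (col n \<gamma> T (Suc j)))"
proof -
  let ?A = "\<lambda>j. {x \<in> pairs_A \<gamma> (rows n \<gamma> (Suc j)). \<not> inv_A (col n \<gamma> T j) (col n \<gamma> T (Suc j)) x}"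
  let ?B = "\<lambda>j. {x \<in> pairs_B \<gamma> (rows n \<gamma> j) (rows n \<gamma> (Suc j)). \<not> inv_B (col n \<gamma> T j) (col n \<gamma> T (Suc j)) x}"
  have inj: "inj_on (triple_A j) X" "inj_on (triple_B j) X" for j X
    by (auto simp: inj_on_def triple_A_def triple_B_def)
  have A: "{\<tau> \<in> triples_A n \<gamma>. \<not> inversion_triple T \<tau>} = (\<Union>j<N. triple_A j ` ?A j)"
    unfolding triples_A_eq[OF assms] by (auto simp: inversion_triple_A)
  have B: "{\<tau> \<in> triples_B n \<gamma>. \<not> inversion_triple T \<tau>} = (\<Union>j<N. triple_B j ` ?B j)"
    unfolding triples_B_eq[OF assms] by (auto simp: inversion_triple_B)
  have "card (\<Union>j<N. triple_A j ` ?A j) = (\<Sum>j<N. card (?A j))"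
    by (subst card_UN_disjoint) (simp_all add: card_image[OF inj(1)], auto simp: triple_A_def)
  moreover have "card (\<Union>j<N. triple_B j ` ?B j) = (\<Sum>j<N. card (?B j))"
    by (subst card_UN_disjoint) (simp_all add: card_image[OF inj(2)], auto simp: triple_B_def)
  moreover have "{\<tau> \<in> triples n \<gamma>. \<not> inversion_triple T \<tau>} = (\<Union>j<N. triple_A j ` ?A j) \<union> (\<Union>j<N. triple_B j ` ?B j)"
    unfolding triples_def A[symmetric] B[symmetric] by auto
  moreover have "(\<Union>j<N. triple_A j ` ?A j) \<inter> (\<Union>j<N. triple_B j ` ?B j) = {}"
    by (auto simp: triple_A_def triple_B_def)
  ultimately show ?thesis
    unfolding coinv_def coinv_step_def by (simp add: card_Un_disjoint sum.distrib)
qed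

lemma dn_eq_sum:
  assumes "\<forall>i\<in>{1..n}. \<gamma> i \<le> N"
  shows "dn n \<gamma> T = (\<Sum>j<N. dn_step (rows n \<gamma> (Suc j)) (col n \<gamma> T j) (col n \<gamma> T (Suc j)))"
proof -
  let ?D = "\<lambda>j. {i \<in> rows n \<gamma> (Suc j). col n \<gamma> T j i \<noteq> col n \<gamma> T (Suc j) i}"
  have lt_N: "j < N" if "i \<in> rows n \<gamma> (Suc j)" for i j
    using mem_rows_le[OF assms that] by simp
  have inj: "inj_on (\<lambda>i. (i, j)) X" for j :: nat and X :: "nat set"
    by (simp add: inj_on_def)
  have eq: "{(i, j). (i, j) \<in> aug_boxes n \<gamma> \<and> (i, Suc j) \<in> aug_boxes n \<gamma> \<and> T (i, j) \<noteq> T (i, Suc j)}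
      = (\<Union>j<N. (\<lambda>i. (i, j)) ` ?D j)"
    by (auto simp: mem_aug_boxes image_iff lt_N intro: rows_SucD)
  show ?thesis
    unfolding dn_def dn_step_def eq
    by (subst card_UN_disjoint) (simp_all add: card_image[OF inj], auto)
qed

text \<open>The product over contents is regrouped into one over boxes, then over columns. The step
  from \<open>j\<close> to \<open>Suc j\<close> is credited with the right column, so the basement
  contributes no factor.\<close>

lemma xweight_eq_prod:
  assumes "\<forall>i\<in>{1..n}. \<gamma> i \<le> N"
  shows "xweight n \<gamma> T = (\<Prod>j<N. xmon (rows n \<gamma> (Suc j)) (col n \<gamma> T (Suc j)))"
proof -
  have fin: "finite (boxes n \<gamma>)"
    by (rule finite_subset[OF _ finite_aug_boxes[of n \<gamma>]]) (auto simp: boxes_def aug_boxes_def)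
  have boxes: "boxes n \<gamma> = (\<lambda>(j, i). (i, Suc j)) ` (SIGMA j:{..<N}. rows n \<gamma> (Suc j))" (is "_ = ?S")
  proof (intro equalityI subsetI)
    fix b assume "b \<in> boxes n \<gamma>"
    then obtain i j where b: "b = (i, j)" "i \<in> {1..n}" "1 \<le> j" "j \<le> \<gamma> i"
      by (auto simp: boxes_def)
    then have "b = (\<lambda>(j, i). (i, Suc j)) (j - 1, i)" and i: "i \<in> rows n \<gamma> (Suc (j - 1))"
      by (auto simp: rows_def)
    moreover have "j - 1 < N"
      using mem_rows_le[OF assms i] by simp
    ultimately show "b \<in> ?S" by blast
  qed (auto simp: boxes_def rows_def)
  have "xweight n \<gamma> T = (\<Prod>v\<in>T ` boxes n \<gamma>. \<Prod>b\<in>{b \<in> boxes n \<gamma>. T b = v}. Var (T b))"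
    unfolding xweight_def weight_def by (intro prod.cong) auto
  also have "\<dots> = (\<Prod>b\<in>boxes n \<gamma>. Var (T b))"
    by (rule prod.image_gen[OF fin, symmetric])
  also have "\<dots> = (\<Prod>(j, i)\<in>(SIGMA j:{..<N}. rows n \<gamma> (Suc j)). Var (T (i, Suc j)))"
    unfolding boxes by (subst prod.reindex) (auto simp: inj_on_def intro!: prod.cong)
  also have "\<dots> = (\<Prod>j<N. \<Prod>i\<in>rows n \<gamma> (Suc j). Var (T (i, Suc j)))"
    by (subst prod.Sigma) auto
  finally show ?thesis
    unfolding xmon_def by simp
qed

text \<open>A monomial determines how often each variable occurs, hence the multiset of column
  entries and with it their sum.\<close>

lemma xmon_eq_imp_sum_eq:
  assumes "xmon A s = xmon A s'" "finite A"
  shows "sum s A = sum s' A"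
proof -
  let ?e = "\<lambda>s. \<Sum>i\<in>A. Poly_Mapping.single (s i) (1::nat)"
  have mon: "xmon A s = Poly_Mapping.single (?e s) 1" for s
    using \<open>finite A\<close> by (induction A) (auto simp: xmon_def Var_def mult_single)
  have "?e s = ?e s'"
    \<comment> \<open>A single term with coefficient \<open>1\<close> has its exponent vector as its
      only key.\<close>
    using assms(1) unfolding mon by (metis keys_single lookup_single_eq one_neq_zero singleton_inject)
  moreover have "Poly_Mapping.lookup (?e s) v = (\<Sum>i\<in>A. of_bool (s i = v))" for s v
    by (simp add: lookup_sum lookup_single) (intro sum.cong, auto simp: when_def)
  ultimately have cnt: "(\<Sum>i\<in>A. of_bool (s i = v) :: nat) = (\<Sum>i\<in>A. of_bool (s' i = v))" for v
    by metis
  define M where "M = s ` A \<union> s' ` A"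
  have "sum r A = (\<Sum>v\<in>M. v * (\<Sum>i\<in>A. of_bool (r i = v)))" if "r ` A \<subseteq> M" for r
  proof -
    have "finite M" using \<open>finite A\<close> by (simp add: M_def)
    have "(\<Sum>v\<in>M. v * (\<Sum>i\<in>A. of_bool (r i = v))) = (\<Sum>i\<in>A. \<Sum>v\<in>M. of_bool (r i = v) * v)"
      unfolding sum_distrib_left by (subst sum.swap) (simp add: mult.commute)
    also have "\<dots> = sum r A"
      using that \<open>finite M\<close> by (intro sum.cong refl sum_of_bool_mult) auto
    finally show ?thesis by simp
  qed
  then show ?thesis
    using cnt by (simp add: M_def)
qed

section \<open>Stretched shapes\<close>

text \<open>The common framework for both families. Since \<open>w\<close> sees only the row sets
  and contents of two adjacent columns, the same matrices serve every stretch factor. Decreasing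
  rows (\<open>dec\<close>) make them triangular for the sum of the entries, and \<open>dist\<close>
  says that a diagonal entry determines this sum.\<close>

lemma exp_sum_stretched_fillings:
  fixes w :: "nat set \<Rightarrow> nat set \<Rightarrow> (nat \<Rightarrow> nat) \<Rightarrow> (nat \<Rightarrow> nat) \<Rightarrow> 'a::idom"
    and f :: "nat \<Rightarrow> filling \<Rightarrow> 'a" and \<alpha> :: "nat \<Rightarrow> nat"
  defines "\<gamma> \<equiv> \<lambda>m i. Suc m * \<alpha> i"
  assumes base: "restrict \<beta> {1..n} \<in> states B {1..n}"
    and X: "\<And>m. X m \<subseteq> aug_fillings n \<beta> (\<gamma> m)"
    and st: "\<And>m T j. T \<in> X m \<Longrightarrow> col n (\<gamma> m) T j \<in> states B (rows n (\<gamma> m) j)"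
    and wt: "\<And>m N T. \<forall>i\<in>{1..n}. \<gamma> m i \<le> N \<Longrightarrow> T \<in> aug_fillings n \<beta> (\<gamma> m) \<Longrightarrow>
      \<forall>j\<le>N. col n (\<gamma> m) T j \<in> states B (rows n (\<gamma> m) j) \<Longrightarrow>
      (if T \<in> X m then f m T else 0) =
        (\<Prod>j<N. w (rows n (\<gamma> m) j) (rows n (\<gamma> m) (Suc j)) (col n (\<gamma> m) T j) (col n (\<gamma> m) T (Suc j)))"
    and dec: "\<And>A s v i. i \<in> A \<Longrightarrow> w A A s v \<noteq> 0 \<Longrightarrow> v i \<le> s i"
    and dist: "\<And>A s v. finite A \<Longrightarrow> s \<in> states B A \<Longrightarrow> v \<in> states B A \<Longrightarrow> w A A s s = w A A v v \<Longrightarrow>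
      sum s A = sum v A"
  shows "exp_sum (\<lambda>m. sum (f m) (X m))"
proof -
  \<comment> \<open>The sum bounds every part of \<alpha>, so \<open>D * Suc m\<close> columns
    suffice for the stretched shape and the last of them ends block \<open>D\<close>. The final
    blocks may have no rows at all.\<close>
  define D where "D = (\<Sum>i\<in>{1..n}. \<alpha> i)"
  let ?s = "restrict \<beta> {1..n}"
  have rows: "rows n (\<gamma> m) j = rows n \<alpha> ((j + m) div Suc m)" for m j
    unfolding \<gamma>_def by (rule rows_stretch)
  have end_block: "(D * Suc m + m) div Suc m = D" for m
    using div_mult_self3[of "Suc m" D m] by (simp del: div_mult_self3)
  have D: "\<forall>i\<in>{1..n}. \<gamma> m i \<le> D * Suc m" for m
  proof
    fix i assume "i \<in> {1..n}"
    then have "\<alpha> i \<le> D" unfolding D_def by (intro member_le_sum) auto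
    then have "Suc m * \<alpha> i \<le> Suc m * D" by (rule mult_le_mono2)
    then show "\<gamma> m i \<le> D * Suc m" by (simp only: \<gamma>_def mult.commute)
  qed
  have "sum (f m) (X m) = (\<Sum>u\<in>states B (rows n (\<gamma> m) (D * Suc m)).
      path_sum (\<lambda>j. states B (rows n (\<gamma> m) j)) (\<lambda>j. w (rows n (\<gamma> m) j) (rows n (\<gamma> m) (Suc j)))
        0 (D * Suc m) ?s u)" for m
    by (rule sum_fillings_eq_path_sum[OF D X st wt[OF D] base])
  then have sum_eq: "sum (f m) (X m) = (\<Sum>u\<in>states B (rows n \<alpha> D).
      path_sum (\<lambda>j. states B (rows n \<alpha> ((j + m) div Suc m)))
        (\<lambda>j. w (rows n \<alpha> ((j + m) div Suc m)) (rows n \<alpha> ((Suc j + m) div Suc m)))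
        0 (D * Suc m) ?s u)" for m
    unfolding rows end_block .
  \<comment> \<open>Entries can only decrease, and two distinct extensional columns differ at some
    row of \<open>A\<close>, so the sum strictly drops.\<close>
  have tri: "sum v A < sum s A"
    if "finite A" "s \<in> states B A" "v \<in> states B A" "w A A s v \<noteq> 0" "s \<noteq> v" for A s v
  proof -
    have le: "v i \<le> s i" if "i \<in> A" for i
      using dec that \<open>w A A s v \<noteq> 0\<close> by blast
    have "s \<in> extensional A" "v \<in> extensional A"
      using that(2,3) by (auto simp: states_def PiE_iff)
    then obtain i where "i \<in> A" "v i \<noteq> s i"
      using \<open>s \<noteq> v\<close> by (metis extensionalityI)
    then have "i \<in> A" "v i < s i"
      using le[of i] by auto
    then show ?thesis
      using le \<open>finite A\<close> by (intro sum_strict_mono_ex1) auto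
  qed
  have "exp_sum (\<lambda>m. path_sum (\<lambda>j. states B (rows n \<alpha> ((j + m) div Suc m)))
        (\<lambda>j. w (rows n \<alpha> ((j + m) div Suc m)) (rows n \<alpha> ((Suc j + m) div Suc m)))
        0 (D * Suc m) ?s u)" if "u \<in> states B (rows n \<alpha> D)" for u
    by (rule exp_sum_block_path_sum[where U = "\<lambda>c. states B (rows n \<alpha> c)"
          and w = "\<lambda>c c'. w (rows n \<alpha> c) (rows n \<alpha> c')" and \<kappa> = "\<lambda>c s. sum s (rows n \<alpha> c)"])
      (use that in \<open>auto intro: tri dist\<close>)
  then show ?thesis
    unfolding sum_eq by (rule exp_sum_sum)
qed

section \<open>Application to the two families of fillings\<close>

lemma pairs_stretch:
  "pairs_A (\<lambda>i. Suc m * \<alpha> i) = pairs_A \<alpha>" "pairs_B (\<lambda>i. Suc m * \<alpha> i) = pairs_B \<alpha>"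
  unfolding pairs_A_def pairs_B_def mult_le_cancel1 mult_less_cancel1 by simp_all

lemma prod_of_bool:
  "(\<Prod>j<(N::nat). of_bool (P j)) = (of_bool (\<forall>j<N. P j) :: 'a::comm_semiring_1)"
  by (induction N) (auto simp: less_Suc_eq)

lemma prod_const_poly: "(\<Prod>j\<in>A. [:g j:]) = [:\<Prod>j\<in>A. g j:]"
  by (induction A rule: infinite_finite_induct) (auto simp: one_pCons mult.commute)

lemma restrict_mem_states:
  "inj_on \<beta> A \<Longrightarrow> (\<And>i. i \<in> A \<Longrightarrow> \<beta> i > 0) \<Longrightarrow> (\<And>i. i \<in> A \<Longrightarrow> \<beta> i \<le> B) \<Longrightarrow>
    restrict \<beta> A \<in> states B A"
  by (auto simp: states_def inj_on_def Suc_le_eq)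

text \<open>
  Equal entries \<open>b\<close> and \<open>c\<close>, with \<open>c\<close> lower, form a type A inversion triple with the left neighbour
  of \<open>b\<close> if the row of \<open>b\<close> is at least as long. Otherwise the row of \<open>c\<close> continues, and \<open>c\<close>, its right
  neighbour and \<open>b\<close> form a type B inversion triple.
\<close>

lemma SSAF_inj_on_col:
  assumes T: "T \<in> SSAF n \<beta> \<gamma>" and inj: "inj_on \<beta> {1..n}"
  shows "inj_on (\<lambda>i. T (i, j)) (rows n \<gamma> j)"
proof (cases j)
  case 0
  have rows0: "rows n \<gamma> 0 = {1..n}"
    by (auto simp: rows_def)
  have "T (i, 0) = \<beta> i" if "i \<in> {1..n}" for i
    using T that by (simp add: SSAF_def aug_fillings_def)
  then have "inj_on (\<lambda>i. T (i, 0)) {1..n} \<longleftrightarrow> inj_on \<beta> {1..n}"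
    by (rule inj_on_cong)
  then show ?thesis
    using inj by (simp only: 0 rows0)
next
  case (Suc j')
  have no_inv: "\<not> inversion_triple T \<tau>" if "\<tau> \<in> triples_A n \<gamma> \<union> triples_B n \<gamma>" for \<tau>
    using T that by (auto simp: SSAF_def triples_def)
  have dec: "T (i, Suc l) \<le> T (i, l)" if "i \<in> rows n \<gamma> (Suc l)" for i l
    using T that by (auto simp: SSAF_def decreasing_rows_def rows_def)
  have ne: "T (i, j) \<noteq> T (i', j)" if i: "i \<in> rows n \<gamma> j" and i': "i' \<in> rows n \<gamma> j" and "i < i'" for i i'
  proof
    assume eq: "T (i, j) = T (i', j)"
    show False
    proof (cases "\<gamma> i' \<le> \<gamma> i")
      case True
      then have "((i, j'), (i, j), (i', j)) \<in> triples_A n \<gamma>"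
        using i i' \<open>i < i'\<close> by (auto simp: triples_A_def mem_aug_boxes Suc rows_def)
      then show False
        using no_inv[of "((i, j'), (i, j), (i', j))"] dec[of i j'] i eq by (simp add: Suc)
    next
      case False
      then have *: "i' \<in> rows n \<gamma> (Suc j)"
        using i i' by (auto simp: rows_def)
      with False have "((i', j), (i', Suc j), (i, j)) \<in> triples_B n \<gamma>"
        using i i' \<open>i < i'\<close> by (auto simp: triples_B_def mem_aug_boxes)
      then show False
        using no_inv[of "((i', j), (i', Suc j), (i, j))"] dec[OF *] eq by simp
    qed
  qed
  then show ?thesis
    unfolding inj_on_def by (metis nat_neq_iff)
qed

text \<open>For a repeated column the two inequalities of an inversion triple force equal entries in
  different rows. Hence an injective column may always be followed by itself, and its diagonal entry
  is a nonzero monomial.\<close>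

lemma not_inv_diagonal:
  assumes "inj_on s A"
  shows "x \<in> pairs_A \<alpha> A \<Longrightarrow> \<not> inv_A s s x" "x \<in> pairs_B \<alpha> A A \<Longrightarrow> \<not> inv_B s s x"
  using inj_onD[OF assms, of "fst x" "snd x"]
  by (auto simp: pairs_A_def pairs_B_def inv_A_def inv_B_def)

text \<open>The step weight is the indicator of an admissible step times the monomial of the new
  column. The eigenvalues are therefore the monomials of the columns, and these determine the column
  sums.\<close>

lemma exp_sum_demazure_atom:
  assumes inj: "inj_on \<beta> {1..n}" and pos: "\<And>i. i \<in> {1..n} \<Longrightarrow> \<beta> i > 0"
  shows "exp_sum (\<lambda>m. demazure_atom n \<beta> (\<lambda>i. Suc m * \<alpha> i))"
proof -
  \<comment> \<open>A crude common bound for the basement entries, hence for all entries.\<close>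
  define B where "B = sum \<beta> {1..n}"
  have B: "\<beta> i \<le> B" if "i \<in> {1..n}" for i
    unfolding B_def using that by (intro member_le_sum) auto
  define w where "w A\<^sub>0 A s s' = of_bool (ssaf_step \<alpha> A\<^sub>0 A s s') * xmon A s'" for A\<^sub>0 A s s'
  \<comment> \<open>Triples depend on row lengths only through comparisons, which a positive factor
    preserves; the step condition is thus independent of \<open>m\<close>.\<close>
  have step: "ssaf_step (\<lambda>i. Suc m * \<alpha> i) = ssaf_step \<alpha>" for m
    unfolding ssaf_step_def fun_eq_iff pairs_stretch by blast
  have diag: "w A A s s = xmon A s" if "s \<in> states B A" for A s
    using that not_inv_diagonal[of s A] by (simp add: w_def ssaf_step_def states_def)
  show ?thesis
    unfolding demazure_atom_def
  proof (rule exp_sum_stretched_fillings[where w = w and B = B])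
    show "restrict \<beta> {1..n} \<in> states B {1..n}"
      by (intro restrict_mem_states inj pos B)
    fix m
    let ?\<gamma> = "\<lambda>i. Suc m * \<alpha> i"
    show "SSAF n \<beta> ?\<gamma> \<subseteq> aug_fillings n \<beta> ?\<gamma>"
      by (auto simp: SSAF_def)
    show "col n ?\<gamma> T j \<in> states B (rows n ?\<gamma> j)" if "T \<in> SSAF n \<beta> ?\<gamma>" for T j
      using that B SSAF_inj_on_col[OF that inj] by (intro col_mem_states) (auto simp: SSAF_def)
    fix N T
    assume N: "\<forall>i\<in>{1..n}. ?\<gamma> i \<le> N" and T: "T \<in> aug_fillings n \<beta> ?\<gamma>"
    show "(if T \<in> SSAF n \<beta> ?\<gamma> then xweight n ?\<gamma> T else 0) =
        (\<Prod>j<N. w (rows n ?\<gamma> j) (rows n ?\<gamma> (Suc j)) (col n ?\<gamma> T j) (col n ?\<gamma> T (Suc j)))"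
      unfolding w_def prod.distrib prod_of_bool xweight_eq_prod[OF N] SSAF_iff_steps[OF T N] step
      by simp
  next
    show "v i \<le> s i" if "i \<in> A" "w A A s v \<noteq> 0" for A s v i
      using that by (auto simp: w_def ssaf_step_def)
    show "sum s A = sum v A"
      if "finite A" "s \<in> states B A" "v \<in> states B A" "w A A s s = w A A v v" for A s v
      using that diag by (intro xmon_eq_imp_sum_eq) metis+
  qed
qed

text \<open>Same scheme, with powers of \<open>t\<close> and \<open>1 - t\<close> in the step
  weight. The basement is the identity, so entries are bounded by \<open>n\<close>.\<close>

lemma exp_sum_hall_littlewood_E:
  "exp_sum (\<lambda>m. hall_littlewood_E n (\<lambda>i. Suc m * \<alpha> i))"
proof -
  define w :: "nat set \<Rightarrow> nat set \<Rightarrow> (nat \<Rightarrow> nat) \<Rightarrow> (nat \<Rightarrow> nat) \<Rightarrow> xpoly poly" where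
    "w A\<^sub>0 A s s' = of_bool (nawf_step A\<^sub>0 A s s') *
      ([:xmon A s':] * tvar ^ coinv_step \<alpha> A\<^sub>0 A s s' * (1 - tvar) ^ dn_step A s s')" for A\<^sub>0 A s s'
  have step: "coinv_step (\<lambda>i. Suc m * \<alpha> i) = coinv_step \<alpha>" for m
    unfolding coinv_step_def fun_eq_iff pairs_stretch by blast
  \<comment> \<open>A repeated column has no descents, so its diagonal entry is a monomial in
    \<open>x\<close> times a power of \<open>t\<close>. Setting \<open>t = 1\<close> removes that
    power and keeps the monomial; the factor \<open>1 - t\<close> would vanish there but occurs with
    exponent \<open>0\<close>.\<close>
  have diag: "poly (w A A s s) 1 = xmon A s" if "s \<in> states n A" for A s
  proof -
    have "nawf_step A A s s"
      using that by (auto simp: nawf_step_def states_def dest: inj_onD)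
    moreover have "dn_step A s s = 0"
      by (simp add: dn_step_def)
    ultimately show ?thesis
      by (simp add: w_def tvar_def)
  qed
  show ?thesis
    unfolding hall_littlewood_E_def
  proof (rule exp_sum_stretched_fillings[where w = w and B = n])
    show "restrict (\<lambda>i. i) {1..n} \<in> states n {1..n}"
      by (intro restrict_mem_states) auto
    fix m
    let ?\<gamma> = "\<lambda>i. Suc m * \<alpha> i"
    show "NAWF n ?\<gamma> \<subseteq> aug_fillings n (\<lambda>i. i) ?\<gamma>"
      by (auto simp: NAWF_def)
    show "col n ?\<gamma> T j \<in> states n (rows n ?\<gamma> j)" if "T \<in> NAWF n ?\<gamma>" for T j
    proof (rule col_mem_states)
      show "inj_on (\<lambda>i. T (i, j)) (rows n ?\<gamma> j)"
      proof (rule inj_onI, rule ccontr)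
        fix i i' assume "i \<in> rows n ?\<gamma> j" "i' \<in> rows n ?\<gamma> j" "T (i, j) = T (i', j)" "i \<noteq> i'"
        then have "attacking T (i, j) (i', j)" "(i, j) \<in> aug_boxes n ?\<gamma>" "(i', j) \<in> aug_boxes n ?\<gamma>"
          by (simp_all add: attacking_def mem_aug_boxes)
        then show False
          using that unfolding NAWF_def non_attacking_def by blast
      qed
    qed (use that in \<open>auto simp: NAWF_def\<close>)
    fix N T
    assume N: "\<forall>i\<in>{1..n}. ?\<gamma> i \<le> N" and T: "T \<in> aug_fillings n (\<lambda>i. i) ?\<gamma>"
      and st: "\<forall>j\<le>N. col n ?\<gamma> T j \<in> states n (rows n ?\<gamma> j)"
    show "(if T \<in> NAWF n ?\<gamma>
        then [:xweight n ?\<gamma> T:] * tvar ^ coinv n ?\<gamma> T * (1 - tvar) ^ dn n ?\<gamma> T else 0) =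
        (\<Prod>j<N. w (rows n ?\<gamma> j) (rows n ?\<gamma> (Suc j)) (col n ?\<gamma> T j) (col n ?\<gamma> T (Suc j)))"
      unfolding w_def prod.distrib prod_of_bool prod_const_poly power_sum[symmetric]
        xweight_eq_prod[OF N] coinv_eq_sum[OF N] dn_eq_sum[OF N] NAWF_iff_steps[OF T N st] step
      by simp
  next
    show "v i \<le> s i" if "i \<in> A" "w A A s v \<noteq> 0" for A s v i
      using that by (auto simp: w_def nawf_step_def)
    show "sum s A = sum v A"
      if "finite A" "s \<in> states n A" "v \<in> states n A" "w A A s s = w A A v v" for A s v
    proof -
      have "xmon A s = xmon A v"
        using diag that(2-4) by metis
      then show ?thesis
        using \<open>finite A\<close> by (rule xmon_eq_imp_sum_eq)
    qed
  qed
qed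

theorem corollary14:
  fixes n :: nat and \<alpha> \<beta> :: "nat \<Rightarrow> nat"
  assumes "n \<ge> 1"
    and "inj_on \<beta> {1..n}"
    and "\<And>i. i \<in> {1..n} \<Longrightarrow> \<beta> i > 0"
  shows "(\<exists>p. satisfies_recurrence (\<lambda>k. demazure_atom n \<beta> (\<lambda>i. k * \<alpha> i)) p \<and> simple_roots p) \<and>
         (\<exists>p. satisfies_recurrence (\<lambda>k. hall_littlewood_E n (\<lambda>i. k * \<alpha> i)) p \<and> simple_roots p)"
  using assms(2,3)
  by (intro conjI exp_sum_imp_recurrence exp_sum_demazure_atom exp_sum_hall_littlewood_E)

end
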